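(* Let $q$ be an odd prime power and let $O(2n+1,q)$ be the orthogonal group of a nondegenerate quadratic form on $\mathbb{F}_q^{2n+1}$, acting naturally on $\mathbb{F}_q^{2n+1}$. Let $g$ be chosen uniformly at random from $O(2n+1,q)$ and let $Z_n$ be the number of vectors $v\in\mathbb{F}_q^{2n+1}$ with $gv=v$. Then for every natural number $j$ and every $n\ge j$, $$E[Z_n^j]=\prod_{i=1}^{j}\left(q^{i}+1\right).$$ *)

theory Defs
  imports "HOL-Probability.Probability" "HOL-Number_Theory.Prime_Powers"
begin

definition polar_form :: "('a::field ^ 'm \<Rightarrow> 'a) \<Rightarrow> 'a ^ 'm \<Rightarrow> 'a ^ 'm \<Rightarrow> 'a" where
  "polar_form Q x y = Q (x + y) - Q x - Q y"

definition quadratic_form :: "('a::field ^ 'm \<Rightarrow> 'a) \<Rightarrow> bool" where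
  "quadratic_form Q \<longleftrightarrow>
     (\<forall>c v. Q (c *s v) = c\<^sup>2 * Q v) \<and>
     (\<forall>x. Vector_Spaces.linear (*s) (*) (\<lambda>y. polar_form Q x y)) \<and>
     (\<forall>y. Vector_Spaces.linear (*s) (*) (\<lambda>x. polar_form Q x y))"

text \<open>Nondegeneracy means that the polar form has trivial radical. This is the standard
  notion in odd characteristic, the only case in which it is used here.\<close>

definition nondegenerate :: "('a::field ^ 'm \<Rightarrow> 'a) \<Rightarrow> bool" where
  "nondegenerate Q \<longleftrightarrow> (\<forall>x. (\<forall>y. polar_form Q x y = 0) \<longrightarrow> x = 0)"

definition orthogonal_group :: "('a::field ^ 'm \<Rightarrow> 'a) \<Rightarrow> ('a ^ 'm \<Rightarrow> 'a ^ 'm) set" where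
  "orthogonal_group Q =
     {g. Vector_Spaces.linear (*s) (*s) g \<and> bij g \<and> (\<forall>v. Q (g v) = Q v)}"

definition num_fixed_vectors :: "('a ^ 'm \<Rightarrow> 'a ^ 'm) \<Rightarrow> nat" where
  "num_fixed_vectors g = card {v. g v = v}"

end

theory Submission
  imports Defs
begin

text \<open>For a subspace \<open>W\<close> let \<open>H\<^sub>W\<close> be its pointwise stabiliser in the orthogonal group.
  By Witt's theorem two vectors \<open>v\<close>, \<open>v'\<close> outside \<open>W\<close> lie in one \<open>H\<^sub>W\<close>-orbit iff
  \<open>Q v = Q v'\<close> and \<open>v - v'\<close> is orthogonal to \<open>W\<close>; as long as \<open>dim W < n\<close>, every functional
  on \<open>W\<close> and every value of \<open>Q\<close> occur, so there are \<open>q |W|\<close> such orbits, besides the \<open>|W|\<close>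
  fixed points in \<open>W\<close>. Splitting off one factor of \<open>Z\<^sup>j\<^sup>+\<^sup>1\<close> as a sum over fixed vectors
  \<open>v\<close> replaces \<open>W\<close> by \<open>W + \<langle>v\<rangle>\<close>, and induction on \<open>j\<close> shows that \<open>Z\<^sup>j\<close> has mean
  \<open>|W|\<^sup>j \<Prod>\<^sub>i (q\<^sup>i + 1)\<close> over \<open>H\<^sub>W\<close> whenever \<open>dim W + j \<le> n\<close>. Dimension bounds are
  expressed through cardinalities: \<open>|W|\<^sup>2 q\<^sup>2\<^sup>j < |V|\<close> says \<open>dim W + j \<le> n\<close>.\<close>

section \<open>Finite fields and counting\<close>

text \<open>Translation by 1 permutes the field, so comparing sums over it gives
  \<open>of_nat CARD('a) = 0\<close>; with odd cardinality and \<open>2 = 0\<close> this reads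
  \<open>1 = 0\<close>.\<close>

lemma two_neq_0_if_odd_CARD:
  assumes "odd CARD('a::{field,finite})"
  shows "(2::'a) \<noteq> 0"
proof
  assume two: "(2::'a) = 0"
  have "(\<Sum>x\<in>UNIV. x) = (\<Sum>x\<in>UNIV. x + 1 :: 'a)"
    by (rule sum.reindex_bij_witness[where i = "\<lambda>x. x + 1" and j = "\<lambda>x. x - 1"]) auto
  then have "of_nat CARD('a) = (0::'a)"
    by (simp add: sum.distrib)
  moreover obtain k where "CARD('a) = 2 * k + 1"
    using assms by (rule oddE)
  ultimately show False
    using two by simp
qed

text \<open>The fibres of \<open>f\<close> on \<open>U\<close> are translates of \<open>K\<close>.
  Only the fibre relation is assumed, so the codomain of \<open>f\<close> may be a bare type, such
  as a type of functions.\<close>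

lemma card_additive_image:
  fixes U :: "'b::{group_add,finite} set"
  assumes "\<And>x y. x \<in> U \<Longrightarrow> y \<in> U \<Longrightarrow> x + y \<in> U"
    and "\<And>x y. x \<in> U \<Longrightarrow> y \<in> U \<Longrightarrow> f x = f y \<longleftrightarrow> x - y \<in> K"
    and "K \<subseteq> U"
  shows "card U = card (f ` U) * card K"
proof -
  have "card {x\<in>U. f x = d} = card K" if "d \<in> f ` U" for d
  proof -
    obtain u where u: "u \<in> U" "d = f u"
      using \<open>d \<in> f ` U\<close> by blast
    have "{x\<in>U. f x = d} = (\<lambda>k. k + u) ` K"
    proof (intro equalityI subsetI)
      fix x assume "x \<in> {x\<in>U. f x = d}"
      then have "x - u \<in> K"
        using assms(2)[of x u] u by simp
      then have "x - u + u \<in> (\<lambda>k. k + u) ` K"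
        by (rule imageI)
      then show "x \<in> (\<lambda>k. k + u) ` K"
        by simp
    next
      fix x assume "x \<in> (\<lambda>k. k + u) ` K"
      then obtain k where k: "k \<in> K" "x = k + u"
        by blast
      then have "x \<in> U"
        using assms(1,3) u by blast
      then show "x \<in> {x\<in>U. f x = d}"
        using assms(2)[of x u] u k by simp
    qed
    then show ?thesis
      by (simp add: card_image)
  qed
  then have "(\<Sum>d\<in>f ` U. card {x\<in>U. f x = d}) = card (f ` U) * card K"
    by simp
  moreover have "(\<Sum>x\<in>U. 1) = (\<Sum>d\<in>f ` U. \<Sum>x\<in>{x\<in>U. f x = d}. 1::nat)"
    by (rule sum.image_gen) simp
  ultimately show ?thesis
    by simp
qed

text \<open>Squaring is at most two-to-one and the field has odd size, so more than half of its
  elements are squares. By pigeonhole the values \<open>a * s\<close> and \<open>d - b * s\<close>,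
  for squares \<open>s\<close>, overlap.\<close>

lemma exists_sum_two_scaled_squares:
  fixes a b d :: "'a::{field,finite}"
  assumes "odd CARD('a)" and "a \<noteq> 0" and "b \<noteq> 0"
  shows "\<exists>x y. a * x\<^sup>2 + b * y\<^sup>2 = d"
proof -
  define S where "S = range (\<lambda>x::'a. x\<^sup>2)"
  have "card {x::'a. x\<^sup>2 = s} \<le> 2" if "s \<in> S" for s
  proof -
    obtain t where "s = t\<^sup>2"
      using \<open>s \<in> S\<close> unfolding S_def by blast
    then have "{x. x\<^sup>2 = s} \<subseteq> {t, - t}"
      by (auto simp: power2_eq_iff)
    then show ?thesis
      using card_mono[of "{t, - t}" "{x. x\<^sup>2 = s}"] card_insert_le_m1[of 2 "{- t}" t] by simp
  qed
  then have "(\<Sum>s\<in>S. card {x::'a. x\<^sup>2 = s}) \<le> (\<Sum>s\<in>S. 2)"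
    by (rule sum_mono)
  then have "CARD('a) \<le> (\<Sum>s\<in>S. 2)"
    using sum.image_gen[of "UNIV::'a set" "\<lambda>_. 1::nat" "\<lambda>x. x\<^sup>2"] by (simp add: S_def)
  moreover have "CARD('a) \<noteq> 2 * card S"
    using assms(1) by auto
  ultimately have large: "CARD('a) < 2 * card S"
    by simp
  define A where "A = (\<lambda>s. a * s) ` S"
  define C where "C = (\<lambda>s. d - b * s) ` S"
  have "card A = card S" "card C = card S"
    unfolding A_def C_def using assms(2,3) by (simp_all add: card_image inj_on_def)
  moreover have "card (A \<union> C) \<le> CARD('a)"
    by (intro card_mono) simp_all
  ultimately have "A \<inter> C \<noteq> {}"
    using large card_Un_disjoint[of A C] by auto
  then obtain x y where "a * x\<^sup>2 = d - b * y\<^sup>2"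
    unfolding A_def C_def S_def by blast
  then have "a * x\<^sup>2 + b * y\<^sup>2 = d"
    by simp
  then show ?thesis
    by blast
qed

lemma card_span_insert:
  fixes W :: "('a::{field,finite} ^ 'm::finite) set"
  assumes "vec.subspace W" and "v \<notin> W"
  shows "card (vec.span (insert v W)) = CARD('a) * card W"
proof -
  have "bij_betw (\<lambda>(k, w). k *s v + w) (UNIV \<times> W) (vec.span (insert v W))"
    unfolding bij_betw_def
  proof
    show "inj_on (\<lambda>(k, w). k *s v + w) (UNIV \<times> W)"
    proof (rule inj_onI, clarsimp)
      fix k w l u
      assume *: "w \<in> W" "u \<in> W" "k *s v + w = l *s v + u"
      then have "(k - l) *s v = u - w"
        by (simp add: vec.scale_left_diff_distrib algebra_simps)
      then have "(k - l) *s v \<in> W"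
        using * assms(1) by (simp add: vec.subspace_diff)
      then have "k = l"
        using assms vec.subspace_scale[of W "(k - l) *s v" "inverse (k - l)"]
        by (cases "k = l") (auto simp del: vec.scale_left_diff_distrib vector_ssub_ldistrib vector_sub_rdistrib)
      with * show "k = l \<and> w = u"
        by simp
    qed
    have span_W: "vec.span W = W"
      using assms(1) vec.span_eq_iff by blast
    show "(\<lambda>(k, w). k *s v + w) ` (UNIV \<times> W) = vec.span (insert v W)"
      unfolding vec.span_insert span_W
    proof (intro equalityI subsetI)
      fix x assume "x \<in> (\<lambda>(k, w). k *s v + w) ` (UNIV \<times> W)"
      then obtain k w where "w \<in> W" "x = k *s v + w"
        by auto
      then have "x - k *s v \<in> W"
        by simp
      then show "x \<in> {x. \<exists>k. x - k *s v \<in> W}"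
        by blast
    next
      fix x assume "x \<in> {x. \<exists>k. x - k *s v \<in> W}"
      then obtain k where "x - k *s v \<in> W"
        by blast
      then show "x \<in> (\<lambda>(k, w). k *s v + w) ` (UNIV \<times> W)"
        by (intro image_eqI[where x = "(k, x - k *s v)"]) simp_all
    qed
  qed
  then have "card ((UNIV :: 'a set) \<times> W) = card (vec.span (insert v W))"
    by (rule bij_betw_same_card)
  then show ?thesis
    by (simp add: card_cartesian_product)
qed

lemma card_span_Un_le:
  fixes W :: "('a::{field,finite} ^ 'm::finite) set"
  assumes "vec.subspace W"
  shows "card (vec.span (W \<union> E)) \<le> card W * CARD('a) ^ card E"
proof -
  have "finite E"
    by simp
  then show ?thesis
  proof (induction E)
    case empty
    show ?case
      using vec.span_minimal[of W W] assms by (simp add: card_mono)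
  next
    case (insert e E)
    let ?U = "vec.span (W \<union> E)"
    have "vec.span (W \<union> insert e E) = vec.span (insert e ?U)"
      unfolding Un_insert_right vec.span_insert vec.span_span ..
    moreover have "card (vec.span (insert e ?U)) \<le> CARD('a) * card ?U"
    proof (cases "e \<in> ?U")
      case True
      then show ?thesis
        by (simp add: insert_absorb vec.span_span)
    qed (simp add: card_span_insert)
    ultimately have "card (vec.span (W \<union> insert e E)) \<le> CARD('a) * card ?U"
      by argo
    also have "\<dots> \<le> CARD('a) * (card W * CARD('a) ^ card E)"
      using insert.IH by (rule mult_le_mono2)
    also have "\<dots> = card W * CARD('a) ^ card (insert e E)"
      using insert.hyps by simp
    finally show ?case .
  qed
qed

section \<open>The polar form and orthogonal complements\<close>

locale odd_quadratic_space =
  fixes Q :: "'a::{field,finite} ^ 'm::finite \<Rightarrow> 'a"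
  assumes quadratic: "quadratic_form Q"
    and nondeg: "nondegenerate Q"
    and odd_card: "odd CARD('a)"
begin

abbreviation B where "B \<equiv> polar_form Q"

definition perp :: "('a ^ 'm) set \<Rightarrow> ('a ^ 'm) set" where
  "perp S = {x. \<forall>w\<in>S. B x w = 0}"

text \<open>This is the pointwise stabiliser. Arbitrary sets are allowed, so that requiring one more
  fixed vector is just \<open>insert v W\<close>; \<open>fixer_span\<close> restores a
  subspace.\<close>

definition fixer :: "('a ^ 'm) set \<Rightarrow> ('a ^ 'm \<Rightarrow> 'a ^ 'm) set" where
  "fixer S = {g \<in> orthogonal_group Q. \<forall>w\<in>S. g w = w}"

lemma two_neq_0 [simp]: "(2::'a) \<noteq> 0"
  using odd_card by (rule two_neq_0_if_odd_CARD)

lemma Q_scale: "Q (c *s v) = c\<^sup>2 * Q v"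
  using quadratic by (simp add: quadratic_form_def)

lemma Q_0 [simp]: "Q 0 = 0"
  using Q_scale[of 0 0] by simp

lemma B_commute: "B x y = B y x"
  by (simp add: polar_form_def algebra_simps)

lemma linear_B: "Vector_Spaces.linear (*s) (*) (B x)"
  using quadratic by (simp add: quadratic_form_def)

lemma B_add_right [simp]: "B x (y + z) = B x y + B x z"
  and B_scale_right [simp]: "B x (c *s y) = c * B x y"
  using linear_B[of x] by (auto simp: Vector_Spaces.linear_iff)

lemma B_add_left [simp]: "B (x + y) z = B x z + B y z"
  and B_scale_left [simp]: "B (c *s x) z = c * B x z"
  by (metis B_commute B_add_right, metis B_commute B_scale_right)

lemma B_minus_left [simp]: "B (- x) y = - B x y"
  and B_minus_right [simp]: "B y (- x) = - B y x"
  using B_scale_left[of "-1" x y] B_scale_right[of y "-1" x] by simp_all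

lemma B_diff_left [simp]: "B (x - y) z = B x z - B y z"
  and B_diff_right [simp]: "B z (x - y) = B z x - B z y"
  using B_add_left[of x "- y" z] B_add_right[of z x "- y"] by simp_all

lemma B_0_left [simp]: "B 0 x = 0" and B_0_right [simp]: "B x 0 = 0"
  using B_scale_left[of 0 0 x] B_scale_right[of x 0 0] by simp_all

lemma B_sum_right: "B x (sum f A) = (\<Sum>i\<in>A. B x (f i))"
  by (induction A rule: infinite_finite_induct) auto

lemma Q_add: "Q (x + y) = Q x + Q y + B x y"
  by (simp add: polar_form_def)

lemma B_self: "B x x = 2 * Q x"
proof -
  have "x + x = 2 *s x"
    by (metis one_add_one vec.scale_left_distrib vec.scale_one)
  then show ?thesis
    using Q_add[of x x] Q_scale[of 2 x] by simp
qed

lemma Q_minus [simp]: "Q (- x) = Q x"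
  using Q_scale[of "-1" x] by simp

lemma Q_diff: "Q (x - y) = Q x + Q y - B x y"
  using Q_add[of x "- y"] by simp

lemma subspace_perp [simp]: "vec.subspace (perp S)"
  by (simp add: perp_def vec.subspace_def)

lemma perp_span [simp]: "perp (vec.span S) = perp S"
proof -
  have "B x w = 0" if "x \<in> perp S" "w \<in> vec.span S" for x w
    using that(2,1) by (induction rule: vec.span_induct_alt) (auto simp: perp_def)
  then show ?thesis
    by (auto simp: perp_def vec.span_base)
qed

text \<open>Nondegeneracy makes \<open>y\<close> depend injectively on the values of
  \<open>B y\<close> at the standard basis; on a finite space this map is then also
  surjective.\<close>

lemma functional_eq_B:
  fixes f :: "'a ^ 'm \<Rightarrow> 'a"
  assumes "Vector_Spaces.linear (*s) (*) f"
  obtains y where "\<And>x. f x = B y x"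
proof -
  define T where "T y = (\<chi> i. B y (axis i 1))" for y
  have expand: "h x = (\<Sum>i\<in>UNIV. x $ i * h (axis i 1))"
    if "Vector_Spaces.linear (*s) (*) h" for h :: "'a ^ 'm \<Rightarrow> 'a" and x
  proof -
    interpret h: Vector_Spaces.linear "(*s)" "(*)" h
      by (rule that)
    have "h x = h (\<Sum>i\<in>UNIV. x $ i *s axis i 1)"
      by (simp add: basis_expansion)
    then show ?thesis
      by (simp add: h.sum h.scale)
  qed
  have "inj T"
  proof
    fix y z assume "T y = T z"
    then have "B y (axis i 1) = B z (axis i 1)" for i
      by (simp add: T_def vec_eq_iff)
    then have "B (y - z) x = 0" for x
      by (subst expand[OF linear_B]) (simp only: B_diff_left, simp)
    then show "y = z"
      using nondeg unfolding nondegenerate_def by (metis right_minus_eq)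
  qed
  then have "surj T"
    by (simp add: finite_UNIV_inj_surj)
  then obtain y where "T y = (\<chi> i. f (axis i 1))"
    by (metis surjD)
  then have "B y (axis i 1) = f (axis i 1)" for i
    by (simp add: T_def vec_eq_iff)
  then have "f x = B y x" for x
    by (simp only: expand[OF assms, of x] expand[OF linear_B, of y x])
  then show thesis
    by (rule that)
qed

text \<open>Represent by \<open>B\<close> a functional that vanishes on \<open>W\<close> and is 1 at
  \<open>v\<close>. The contrapositive says that the double complement of \<open>W\<close> lies in
  \<open>W\<close>.\<close>

lemma exists_perp_B_neq_0:
  assumes "vec.subspace W" and "v \<notin> W"
  obtains y where "y \<in> perp W" and "B v y \<noteq> 0"
proof -
  interpret vector_space_pair "(*s) :: 'a \<Rightarrow> 'a ^ 'm \<Rightarrow> 'a ^ 'm" "(*) :: 'a \<Rightarrow> 'a \<Rightarrow> 'a"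
    by unfold_locales (auto simp: algebra_simps)
  obtain C where C: "C \<subseteq> W" "vec.independent C" "vec.span C = W"
    using vec.basis_exists[of W] assms(1) by (metis vec.span_subspace)
  then have "vec.independent (insert v C)"
    using assms(2) by (simp add: vec.independent_insert)
  then obtain f :: "'a ^ 'm \<Rightarrow> 'a" where f: "Vector_Spaces.linear (*s) (*) f"
      and f_eq: "\<forall>x\<in>insert v C. f x = (if x = v then 1 else 0)"
    using linear_independent_extend[of "insert v C" "\<lambda>x. if x = v then 1 else 0"] by auto
  obtain y where y: "\<And>x. f x = B y x"
    using functional_eq_B[OF f] by blast
  have "y \<in> perp C"
    using f_eq C assms(2) by (auto simp: perp_def simp flip: y)
  moreover have "B v y \<noteq> 0"
    using f_eq by (simp add: B_commute[of v] flip: y)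
  ultimately show thesis
    using that C perp_span by metis
qed

text \<open>Each new independent vector \<open>v\<close> multiplies the span by
  \<open>CARD('a)\<close> and divides the complement by it, because \<open>B v\<close> maps
  \<open>perp S\<close> onto the field with kernel \<open>perp (insert v S)\<close>.\<close>

lemma card_perp:
  assumes "vec.subspace W"
  shows "card W * card (perp W) = CARD('a ^ 'm)"
proof -
  have "finite S \<Longrightarrow> card (vec.span S) * card (perp S) = CARD('a ^ 'm)" for S
  proof (induction S rule: finite_induct)
    case empty
    then show ?case
      by (simp add: perp_def)
  next
    case (insert v S)
    show ?case
    proof (cases "v \<in> vec.span S")
      case True
      then show ?thesis
        using insert.IH perp_span by (metis vec.span_redundant)
    next
      case False
      let ?W = "vec.span S"
      obtain y where y: "y \<in> perp S" "B v y \<noteq> 0"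
        using exists_perp_B_neq_0[OF _ False] by auto
      have "c \<in> B v ` perp S" for c
        using y vec.subspace_scale[OF subspace_perp y(1), of "c / B v y"]
        by (intro image_eqI[where x = "(c / B v y) *s y"]) auto
      then have "B v ` perp S = UNIV"
        by auto
      moreover have "card (perp S) = card (B v ` perp S) * card (perp (insert v S))"
        by (rule card_additive_image)
          (auto simp: vec.subspace_add vec.subspace_diff, auto simp: perp_def B_commute[of _ v])
      moreover have "card (vec.span (insert v S)) = CARD('a) * card ?W"
        using card_span_insert[OF _ False] by (simp add: vec.span_insert vec.span_span)
      ultimately show ?thesis
        using insert.IH by (simp add: mult_ac)
    qed
  qed
  moreover have "vec.span W = W"
    using assms by simp
  ultimately show ?thesis
    by (metis finite)
qed

section \<open>Explicit isometries and Witt transitivity\<close>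

lemma orthogonal_groupI:
  assumes "Vector_Spaces.linear (*s) (*s) g" and "\<And>v. Q (g v) = Q v"
  shows "g \<in> orthogonal_group Q"
proof -
  interpret g: Vector_Spaces.linear "(*s)" "(*s)" g
    by (rule assms(1))
  have B_eq: "B (g x) (g y) = B x y" for x y
    using assms(2) by (simp add: polar_form_def flip: g.add)
  have "inj g"
  proof
    fix x y assume "g x = g y"
    then have "B (x - y) z = 0" for z
      using B_eq[of x z] B_eq[of y z] by simp
    then show "x = y"
      using nondeg unfolding nondegenerate_def by (metis right_minus_eq)
  qed
  then have "bij g"
    by (simp add: bij_def finite_UNIV_inj_surj)
  then show ?thesis
    using assms by (simp add: orthogonal_group_def)
qed

text \<open>The third assumption is the expansion of \<open>Q (g x) - Q x = 0\<close> for the map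
  \<open>g\<close> in the conclusion. This shape covers reflections, Eichler transformations and
  scalings of hyperbolic pairs.\<close>

lemma rank_two_perturbation_in_fixer:
  assumes "a \<in> perp S" and "b \<in> perp S"
    and "\<And>x. (B x a)\<^sup>2 * Q u + (B x b)\<^sup>2 * Q f + B x a * B x u + B x b * B x f
             + B x a * B x b * B u f = 0"
  shows "(\<lambda>x. x + B x a *s u + B x b *s f) \<in> fixer S"
proof -
  let ?g = "\<lambda>x. x + B x a *s u + B x b *s f"
  have "Vector_Spaces.linear (*s) (*s) ?g"
    by (simp add: Vector_Spaces.linear_iff vec.vector_space_axioms vec_eq_iff algebra_simps)
  moreover have "Q (?g x) = Q x" for x
    using assms(3)[of x] by (simp add: Q_add Q_scale algebra_simps)
  ultimately have "?g \<in> orthogonal_group Q"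
    by (rule orthogonal_groupI)
  moreover have "?g w = w" if "w \<in> S" for w
    using assms(1,2) that by (simp add: perp_def B_commute[of w])
  ultimately show ?thesis
    by (simp add: fixer_def)
qed

text \<open>This is the part of Witt's theorem that the orbit count needs. The position of
  \<open>u = v' - v\<close> decides which explicit isometry moves \<open>v\<close> to
  \<open>v'\<close>.\<close>

lemma fixer_transitive:
  assumes W: "vec.subspace W" and v: "v \<notin> W" "v' \<notin> W"
    and diff: "v' - v \<in> perp W" and Q_eq: "Q v' = Q v"
  obtains h where "h \<in> fixer W" and "h v = v'"
proof -
  define u where "u = v' - v"
  have v': "v' = v + u"
    by (simp add: u_def)
  have u: "u \<in> perp W"
    using diff by (simp add: u_def)
  \<comment> \<open>This makes the reflection in \<open>u\<close> send \<open>v\<close> to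
    \<open>v + u\<close> if \<open>Q u\<close> is nonzero, and makes \<open>v\<close> orthogonal to
    \<open>u\<close> otherwise.\<close>
  have Qu: "B v u = - Q u"
    using Q_eq by (simp add: v' Q_add add_eq_0_iff)
  have perp_scale: "c *s x \<in> perp W" if "x \<in> perp W" for c x
    using that by (simp add: vec.subspace_scale)
  consider "Q u \<noteq> 0" | "Q u = 0" "v \<notin> vec.span (insert u W)" | "Q u = 0" "v \<in> vec.span (insert u W)"
    by blast
  then show thesis
  proof cases
    case 1
    \<comment> \<open>the reflection in \<open>u\<close>\<close>
    have "(\<lambda>x. x + B x ((- 1 / Q u) *s u) *s u + B x 0 *s 0) \<in> fixer W"
      by (rule rank_two_perturbation_in_fixer)
        (use u 1 in \<open>auto simp: perp_scale vec.subspace_neg vec.subspace_0 field_simps power2_eq_square\<close>)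
    then show thesis
      by (rule that) (use 1 in \<open>simp add: v' Qu\<close>)
  next
    case 2
    obtain z where z: "z \<in> perp (insert u W)" "B v z \<noteq> 0"
      using exists_perp_B_neq_0[OF _ 2(2)] by auto
    define y where "y = (1 / B v z) *s z"
    have y: "y \<in> perp W" "B u y = 0" "B v y = 1"
      using z by (auto simp: y_def perp_def B_commute[of u])
    \<comment> \<open>an Eichler transformation; it maps \<open>v\<close> to \<open>v + B v y *s u\<close>\<close>
    have "(\<lambda>x. x + B x (y - Q y *s u) *s u + B x (- u) *s y) \<in> fixer W"
      by (rule rank_two_perturbation_in_fixer)
        (use u y 2 in \<open>auto simp: perp_scale vec.subspace_diff vec.subspace_neg
            algebra_simps power2_eq_square\<close>)
    then show thesis
      by (rule that) (use y Qu 2 in \<open>simp add: v'\<close>)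
  next
    case 3
    obtain c where "v - c *s u \<in> vec.span W"
      using 3(2) vec.span_breakdown_eq by blast
    then have c: "v - c *s u \<in> W"
      using vec.span_minimal[OF order_refl W] by blast
    have "u \<notin> W"
      using c v(1) W vec.subspace_add[OF W c vec.subspace_scale[OF W, of u c]] by auto
    then obtain z where z: "z \<in> perp W" "B u z \<noteq> 0"
      using exists_perp_B_neq_0[OF W] by blast
    \<comment> \<open>Modulo \<open>W\<close>, the vectors \<open>v\<close> and \<open>v'\<close>
      are \<open>c *s u\<close> and \<open>(c + 1) *s u\<close>. Neither lies in \<open>W\<close>,
      so both coefficients are nonzero and their ratio \<open>l\<close> below is an invertible
      scaling.\<close>
    have "c \<noteq> 0"
      using c v(1) by auto
    have "c + 1 \<noteq> 0"
    proof
      assume "c + 1 = 0"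
      then have "v - c *s u = v'"
        by (simp add: v' add_eq_0_iff2)
      then show False
        using c v(2) by simp
    qed
    define y where "y = (1 / B u z) *s z"
    have y: "y \<in> perp W" "B u y = 1"
      using z by (simp_all add: y_def perp_scale)
    \<comment> \<open>As \<open>B u u = 2 * Q u = 0\<close>, the correction leaves
      \<open>B u y = 1\<close> unchanged while making the vector isotropic.\<close>
    define f where "f = y - Q y *s u"
    have f: "f \<in> perp W" "B u f = 1" "Q f = 0"
      using y u 3(1) by (simp_all add: f_def perp_scale vec.subspace_diff Q_diff Q_scale
          B_self B_commute[of y u])
    define l where "l = (c + 1) / c"
    have l: "l \<noteq> 0" "(l - 1) * c = 1"
      using \<open>c \<noteq> 0\<close> \<open>c + 1 \<noteq> 0\<close> by (simp_all add: l_def field_simps)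
    \<comment> \<open>scales the hyperbolic pair \<open>(u, f)\<close> to \<open>(l u, f / l)\<close>; modulo \<open>W\<close> we have
      \<open>v = c u\<close> and \<open>v' = (c + 1) u\<close>\<close>
    have "(\<lambda>x. x + B x ((l - 1) *s f) *s u + B x ((1 / l - 1) *s u) *s f) \<in> fixer W"
    proof (rule rank_two_perturbation_in_fixer)
      fix x
      \<comment> \<open>This is \<open>l * (1 / l) = 1\<close> written in terms of
        \<open>l - 1\<close> and \<open>1 / l - 1\<close>.\<close>
      have "(l - 1) + (1 / l - 1) + (l - 1) * (1 / l - 1) = 0"
        using l(1) by (simp add: field_simps)
      then have "B x f * B x u * ((l - 1) + (1 / l - 1) + (l - 1) * (1 / l - 1)) = 0"
        by simp
      then show "(B x ((l - 1) *s f))\<^sup>2 * Q u + (B x ((1 / l - 1) *s u))\<^sup>2 * Q f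
          + B x ((l - 1) *s f) * B x u + B x ((1 / l - 1) *s u) * B x f
          + B x ((l - 1) *s f) * B x ((1 / l - 1) *s u) * B u f = 0"
        using f 3(1) by (simp only: B_scale_right) algebra
    qed (use f u in \<open>simp_all only: perp_scale\<close>)
    then show thesis
    proof (rule that)
      have "B f (v - c *s u) = 0"
        using f(1) c by (auto simp: perp_def)
      then have "B v f = c"
        using f(2) by (simp add: B_commute[of f])
      then have "B v ((l - 1) *s f) = 1" "B v ((1 / l - 1) *s u) = 0"
        using l(2) Qu 3(1) by (simp_all only: B_scale_right) simp
      then show "v + B v ((l - 1) *s f) *s u + B v ((1 / l - 1) *s u) *s f = v'"
        by (simp only: v' vec.scale_one vec.scale_zero_left add_0_right)
    qed
  qed
qed

section \<open>Vectors with prescribed products and value\<close>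

text \<open>Used to build orthogonal anisotropic vectors in \<open>perp W\<close> one at a time. In
  dimensions, the size bound says that twice dim \<open>W\<close> plus \<open>card E\<close> is less
  than dim \<open>V\<close>.\<close>

lemma exists_anisotropic_in_perp:
  assumes W: "vec.subspace W" and E: "E \<subseteq> perp W" "\<And>e. e \<in> E \<Longrightarrow> Q e \<noteq> 0"
    and orth: "\<And>e e'. e \<in> E \<Longrightarrow> e' \<in> E \<Longrightarrow> e \<noteq> e' \<Longrightarrow> B e e' = 0"
    and small: "(card W)\<^sup>2 * CARD('a) ^ card E < CARD('a ^ 'm)"
  obtains x where "x \<in> perp (W \<union> E)" and "Q x \<noteq> 0"
proof -
  let ?U = "perp (W \<union> E)"
  \<comment> \<open>otherwise \<open>?U\<close> is totally isotropic, so \<open>?U \<subseteq> span (W \<union> E)\<close>, which forces \<open>?U \<subseteq> W\<close>\<close>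
  have "\<exists>x\<in>?U. Q x \<noteq> 0"
  proof (rule ccontr)
    assume "\<not> (\<exists>x\<in>?U. Q x \<noteq> 0)"
    then have Q0: "Q x = 0" if "x \<in> ?U" for x
      using that by blast
    have "u \<in> W" if u: "u \<in> ?U" for u
    proof -
      have "B u y = 0" if "y \<in> ?U" for y
        using Q0[of u] Q0[of y] Q0[of "u + y"] u that by (simp add: Q_add vec.subspace_add)
      then have "u \<in> vec.span (W \<union> E)"
        using exists_perp_B_neq_0[of "vec.span (W \<union> E)" u] by auto
      moreover have "vec.span W = W"
        using W vec.span_eq_iff by blast
      ultimately obtain w s where ws: "u = w + s" "w \<in> W" "s \<in> vec.span E"
        unfolding vec.span_Un by auto
      then obtain c where s: "s = (\<Sum>e\<in>E. c e *s e)"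
        using vec.span_finite[of E] by auto
      \<comment> \<open>Pairing \<open>u = w + s\<close> with \<open>e\<close> kills
        \<open>u\<close> and \<open>w\<close>; orthogonality leaves only
        \<open>c e * (2 * Q e)\<close> from \<open>s\<close>.\<close>
      have "c e = 0" if e: "e \<in> E" for e
      proof -
        have "B e w = 0" "B e u = 0"
          using u e E(1) ws(2) by (auto simp: perp_def B_commute[of e u])
        then have "0 = B e s"
          by (simp add: ws(1))
        also have "\<dots> = (\<Sum>d\<in>E. c d * B e d)"
          by (simp add: s B_sum_right)
        also have "\<dots> = (\<Sum>d\<in>E. if d = e then c e * B e e else 0)"
          using orth[OF e] by (intro sum.cong) auto
        also have "\<dots> = c e * (2 * Q e)"
          using e by (simp add: B_self)
        finally show ?thesis
          using E(2)[OF e] by simp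
      qed
      then show ?thesis
        using ws by (simp add: s)
    qed
    then have "card ?U \<le> card W"
      by (intro card_mono) auto
    then have "card (vec.span (W \<union> E)) * card ?U \<le> (card W * CARD('a) ^ card E) * card W"
      using card_span_Un_le[OF W] by (rule mult_le_mono[rotated])
    moreover have "card (vec.span (W \<union> E)) * card ?U = CARD('a ^ 'm)"
      using card_perp[of "vec.span (W \<union> E)"] by simp
    ultimately show False
      using small by (simp add: power2_eq_square mult_ac)
  qed
  then show thesis
    using that by blast
qed

text \<open>Changing \<open>v0\<close> by vectors of \<open>perp W\<close> keeps its products with
  \<open>W\<close>. Three orthogonal anisotropic vectors there suffice: two adjust \<open>Q\<close>
  through a sum of two scaled squares, the third secures \<open>v\<close> outside
  \<open>W\<close>.\<close>

lemma exists_prescribed_products_and_value: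
  assumes W: "vec.subspace W" and small: "(card W)\<^sup>2 * CARD('a)\<^sup>2 < CARD('a ^ 'm)"
  obtains v where "v \<notin> W" and "\<And>w. w \<in> W \<Longrightarrow> B v w = B v0 w" and "Q v = c"
proof -
  have small': "(card W)\<^sup>2 * CARD('a) ^ k < CARD('a ^ 'm)" if "k \<le> 2" for k
  proof -
    have "(card W)\<^sup>2 * CARD('a) ^ k \<le> (card W)\<^sup>2 * CARD('a)\<^sup>2"
      using that by (intro mult_le_mono2 power_increasing) (auto simp: Suc_le_eq)
    then show ?thesis
      using small by linarith
  qed
  obtain e1 where e1: "e1 \<in> perp W" "Q e1 \<noteq> 0"
  proof (rule exists_anisotropic_in_perp[OF W, of "{}"])
    show "(card W)\<^sup>2 * CARD('a) ^ card ({} :: ('a ^ 'm) set) < CARD('a ^ 'm)"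
      by (rule small') simp
  qed (simp_all add: that)
  obtain e2 where e2: "e2 \<in> perp W" "B e2 e1 = 0" "Q e2 \<noteq> 0"
  proof (rule exists_anisotropic_in_perp[OF W, of "{e1}"])
    show "(card W)\<^sup>2 * CARD('a) ^ card {e1} < CARD('a ^ 'm)"
      by (rule small') simp
  qed (use e1 in \<open>auto simp: perp_def intro: that\<close>)
  obtain e3 where e3': "e3 \<in> perp W" "B e3 e1 = 0" "B e3 e2 = 0" and e3: "Q e3 \<noteq> 0"
  proof (rule exists_anisotropic_in_perp[OF W, of "{e1, e2}"])
    show "(card W)\<^sup>2 * CARD('a) ^ card {e1, e2} < CARD('a ^ 'm)"
      by (rule small') (simp add: card_insert_if)
    show "B e e' = 0" if "e \<in> {e1, e2}" "e' \<in> {e1, e2}" "e \<noteq> e'" for e e'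
      using that e2(2) B_commute[of e1 e2] by auto
  qed (use e1 e2 in \<open>auto simp: perp_def intro: that\<close>)
  \<comment> \<open>The coefficient of the orthogonal projection to \<open>e\<close>, as
    \<open>B e e = 2 * Q e\<close>. Removing the projections makes \<open>Q v\<close> split without
    cross terms.\<close>
  define p where "p e = B v0 e / (2 * Q e)" for e
  define v1 where "v1 = v0 - p e1 *s e1 - p e2 *s e2 - p e3 *s e3"
  note orth = e2(2) e3'(2,3) trans[OF B_commute e2(2)] trans[OF B_commute e3'(2)]
    trans[OF B_commute e3'(3)]
  have v1: "B v1 e1 = 0" "B v1 e2 = 0" "B v1 e3 = 0"
    using e1(2) e2(3) e3 by (simp_all add: v1_def p_def B_self orth)
  obtain x y where xy: "Q e1 * x\<^sup>2 + Q e2 * y\<^sup>2 = c - Q v1 - Q e3"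
    using exists_sum_two_scaled_squares[OF odd_card e1(2) e2(3)] by blast
  \<comment> \<open>the summand \<open>e3\<close> only serves to keep \<open>v\<close> out of \<open>W\<close>\<close>
  define v where "v = v1 + x *s e1 + y *s e2 + e3"
  have "B v e3 = 2 * Q e3"
    by (simp add: v_def v1 orth B_self)
  then have "v \<notin> W"
    using e3 e3'(1) by (auto simp: perp_def B_commute[of v])
  moreover have "B v w = B v0 w" if "w \<in> W" for w
    using that e1(1) e2(1) e3'(1) by (simp add: v_def v1_def perp_def)
  moreover have "Q v = Q v1 + (Q e1 * x\<^sup>2 + Q e2 * y\<^sup>2) + Q e3"
    by (simp add: v_def Q_add Q_scale v1 orth)
  then have "Q v = c"
    by (simp add: xy)
  ultimately show thesis
    using that by blast
qed

section \<open>Orbits of the pointwise stabilisers\<close>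

lemma B_orthogonal_group:
  assumes "g \<in> orthogonal_group Q"
  shows "B (g x) (g y) = B x y"
proof -
  interpret g: Vector_Spaces.linear "(*s)" "(*s)" g
    using assms by (simp add: orthogonal_group_def)
  show ?thesis
    using assms by (simp add: orthogonal_group_def polar_form_def flip: g.add)
qed

lemma fixer_comp:
  assumes "g \<in> fixer S" and "h \<in> fixer S"
  shows "h \<circ> g \<in> fixer S"
  using assms unfolding fixer_def orthogonal_group_def
  by (auto intro: Vector_Spaces.linear_compose bij_comp)

lemma id_in_fixer: "id \<in> fixer S"
  by (simp add: fixer_def orthogonal_group_def vec.linear_id)

lemma fixer_span: "fixer (vec.span S) = fixer S"
proof -
  have "g w = w" if g: "g \<in> fixer S" and w: "w \<in> vec.span S" for g w
  proof -
    interpret g: Vector_Spaces.linear "(*s)" "(*s)" g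
      using g by (simp add: fixer_def orthogonal_group_def)
    show ?thesis
      using w g by (induction rule: vec.span_induct_alt) (auto simp: g.add g.scale fixer_def)
  qed
  then show ?thesis
    by (auto simp: fixer_def vec.span_base)
qed

text \<open>Precomposition with the surjective map \<open>g\<close> is injective. Applied in both
  directions between two vectors of an orbit, this gives equal fibres without closure of
  \<open>fixer S\<close> under inverses.\<close>

lemma card_fixer_fibre_le:
  assumes "g \<in> fixer S" and "g u = v"
  shows "card {h\<in>fixer S. h v = x} \<le> card {h\<in>fixer S. h u = x}"
proof (rule card_inj_on_le[where f = "\<lambda>h. h \<circ> g"])
  have "surj g"
    using assms(1) by (simp add: fixer_def orthogonal_group_def bij_is_surj)
  then show "inj_on (\<lambda>h. h \<circ> g) {h\<in>fixer S. h v = x}"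
    by (auto simp: inj_on_def surj_fun_eq)
  show "(\<lambda>h. h \<circ> g) ` {h\<in>fixer S. h v = x} \<subseteq> {h\<in>fixer S. h u = x}"
    using assms fixer_comp[OF assms(1)] by auto
qed simp

text \<open>A complete invariant of the \<open>fixer W\<close>-orbits outside \<open>W\<close>. The
  value 0 off \<open>W\<close> makes equality of functions mean equality of functionals on
  \<open>W\<close>.\<close>

definition invariant :: "('a ^ 'm) set \<Rightarrow> 'a ^ 'm \<Rightarrow> ('a ^ 'm \<Rightarrow> 'a) \<times> 'a" where
  "invariant W v = ((\<lambda>w. if w \<in> W then B v w else 0), Q v)"

lemma invariant_eq_iff: "invariant W v = invariant W v' \<longleftrightarrow> v - v' \<in> perp W \<and> Q v = Q v'"
  by (auto simp: invariant_def perp_def fun_eq_iff)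

text \<open>There are \<open>CARD('a ^ 'm) / card (perp W) = card W\<close> functionals
  \<open>B v\<close> on \<open>W\<close>, and each occurs with every value of \<open>Q\<close> at
  some vector outside \<open>W\<close>.\<close>

lemma card_invariant_image:
  assumes W: "vec.subspace W" and small: "(card W)\<^sup>2 * CARD('a)\<^sup>2 < CARD('a ^ 'm)"
  shows "card (invariant W ` (- W)) = card W * CARD('a)"
proof -
  let ?f = "\<lambda>v w. if w \<in> W then B v w else 0"
  have "CARD('a ^ 'm) = card (range ?f) * card (perp W)"
    by (rule card_additive_image) (auto simp: perp_def fun_eq_iff)
  moreover have "0 \<in> perp W"
    by (simp add: perp_def)
  then have "card (perp W) \<noteq> 0"
    by auto
  ultimately have "card (range ?f) = card W"
    using card_perp[OF W] by simp
  moreover have "invariant W ` (- W) = range ?f \<times> UNIV"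
  proof (intro equalityI subsetI)
    fix d :: "('a ^ 'm \<Rightarrow> 'a) \<times> 'a"
    assume "d \<in> range ?f \<times> UNIV"
    then obtain v0 c where d: "d = (?f v0, c)"
      by auto
    obtain v where "v \<notin> W" "\<And>w. w \<in> W \<Longrightarrow> B v w = B v0 w" "Q v = c"
      using exists_prescribed_products_and_value[OF assms] by blast
    then have "v \<in> - W" "invariant W v = d"
      by (auto simp: d invariant_def)
    then show "d \<in> invariant W ` (- W)"
      by blast
  qed (auto simp: invariant_def)
  ultimately show ?thesis
    by (simp add: card_cartesian_product)
qed

text \<open>Orbit-stabiliser in summed form: \<open>F\<close> is the orbit of \<open>v0\<close>,
  each stabiliser of \<open>v\<close> in \<open>F\<close> has as many elements as the set of
  \<open>h\<close> with \<open>h v0 = v\<close>, and these sets partition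
  \<open>fixer W\<close>.\<close>

lemma sum_card_fixer_insert_orbit:
  assumes W: "vec.subspace W" and v0: "v0 \<notin> W"
  defines "F \<equiv> {v\<in>- W. invariant W v = invariant W v0}"
  shows "(\<Sum>v\<in>F. card (fixer (insert v W))) = card (fixer W)"
proof -
  have "card (fixer (insert v W)) = card {h\<in>fixer W. h v0 = v}" if "v \<in> F" for v
  proof -
    have v: "v \<notin> W" "v - v0 \<in> perp W" "Q v = Q v0" "v0 - v \<in> perp W"
      using that vec.subspace_neg[OF subspace_perp, of "v - v0" W]
      by (auto simp: F_def invariant_eq_iff)
    obtain g where g: "g \<in> fixer W" "g v0 = v"
      using fixer_transitive[OF W v0 v(1,2,3)] by blast
    obtain k where k: "k \<in> fixer W" "k v = v0"
      using fixer_transitive[OF W v(1) v0 v(4)] v(3) by metis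
    have "card {h\<in>fixer W. h v = v} = card {h\<in>fixer W. h v0 = v}"
      using card_fixer_fibre_le[OF g] card_fixer_fibre_le[OF k] by (rule order_antisym)
    moreover have "fixer (insert v W) = {h\<in>fixer W. h v = v}"
      by (auto simp: fixer_def)
    ultimately show ?thesis
      by simp
  qed
  moreover have "h v0 \<in> F" if h: "h \<in> fixer W" for h
  proof -
    have O: "h \<in> orthogonal_group Q" and fix_W: "\<And>w. w \<in> W \<Longrightarrow> h w = w"
      using h by (auto simp: fixer_def)
    have "inj h"
      using O by (simp add: orthogonal_group_def bij_is_inj)
    then have "h v0 \<notin> W"
      using fix_W v0 by (metis injD)
    moreover have "B (h v0) w = B v0 w" if "w \<in> W" for w
      using B_orthogonal_group[OF O, of v0 w] fix_W[OF that] by simp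
    moreover have "Q (h v0) = Q v0"
      using O by (simp add: orthogonal_group_def)
    ultimately show ?thesis
      by (simp add: F_def invariant_eq_iff perp_def)
  qed
  then have "(\<Sum>v\<in>F. \<Sum>h\<in>{h\<in>fixer W. h v0 = v}. 1::nat) = (\<Sum>h\<in>fixer W. 1)"
    by (intro sum.group) auto
  ultimately show ?thesis
    by simp
qed

lemma sum_card_fixer_insert:
  assumes "vec.subspace W" and "(card W)\<^sup>2 * CARD('a)\<^sup>2 < CARD('a ^ 'm)"
  shows "(\<Sum>v\<in>- W. card (fixer (insert v W))) = card (fixer W) * (card W * CARD('a))"
proof -
  have "(\<Sum>v\<in>- W. card (fixer (insert v W)))
      = (\<Sum>d\<in>invariant W ` (- W). \<Sum>v\<in>{v\<in>- W. invariant W v = d}. card (fixer (insert v W)))"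
    by (rule sum.image_gen) simp
  also have "\<dots> = (\<Sum>d\<in>invariant W ` (- W). card (fixer W))"
    using sum_card_fixer_insert_orbit[OF assms(1)] by (intro sum.cong) auto
  finally show ?thesis
    by (simp add: card_invariant_image[OF assms])
qed

section \<open>Moments of the number of fixed vectors\<close>

lemma sum_fixed_vectors_power:
  assumes "vec.subspace W" and "(card W)\<^sup>2 * CARD('a) ^ (2 * j) < CARD('a ^ 'm)"
  shows "(\<Sum>h\<in>fixer W. num_fixed_vectors h ^ j)
    = card (fixer W) * (card W ^ j * (\<Prod>i=1..j. CARD('a) ^ i + 1))"
  using assms
proof (induction j arbitrary: W)
  case 0
  then show ?case
    by simp
next
  case (Suc j)
  let ?q = "CARD('a)"
  let ?P = "\<Prod>i=1..j. ?q ^ i + 1"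
  have q: "0 < ?q"
    by simp
  have le: "(card W)\<^sup>2 * ?q ^ k < CARD('a ^ 'm)" if "k \<le> 2 * Suc j" for k
  proof -
    have "(card W)\<^sup>2 * ?q ^ k \<le> (card W)\<^sup>2 * ?q ^ (2 * Suc j)"
      using that q by (intro mult_le_mono2 power_increasing) (auto simp: Suc_le_eq)
    then show ?thesis
      using Suc.prems(2) by linarith
  qed
  have fixer_insert: "fixer (insert v W) = {h\<in>fixer W. h v = v}" for v
    by (auto simp: fixer_def)
  have outside: "(\<Sum>h\<in>fixer (insert v W). num_fixed_vectors h ^ j)
      = card (fixer (insert v W)) * ((?q * card W) ^ j * ?P)" if "v \<notin> W" for v
  proof -
    have card_span: "card (vec.span (insert v W)) = ?q * card W"
      using card_span_insert[OF Suc.prems(1) that] .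
    have "(?q * card W)\<^sup>2 * ?q ^ (2 * j) = (card W)\<^sup>2 * ?q ^ (2 * Suc j)"
      by (simp add: power2_eq_square)
    then have "(card (vec.span (insert v W)))\<^sup>2 * ?q ^ (2 * j) < CARD('a ^ 'm)"
      using Suc.prems(2) card_span by simp
    from Suc.IH[OF vec.subspace_span this] show ?thesis
      by (simp only: fixer_span card_span)
  qed
  have inside: "(\<Sum>h\<in>fixer (insert v W). num_fixed_vectors h ^ j)
      = card (fixer W) * (card W ^ j * ?P)" if "v \<in> W" for v
  proof -
    have "insert v W = W"
      using that by (rule insert_absorb)
    then show ?thesis
      using Suc.IH[OF Suc.prems(1) le[of "2 * j"]] by simp
  qed
  \<comment> \<open>One factor becomes a sum over fixed vectors \<open>v\<close>; after the swap,
    the inner sum runs over the stabiliser of \<open>v\<close> in \<open>fixer W\<close>.\<close>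
  have "(\<Sum>h\<in>fixer W. num_fixed_vectors h ^ Suc j)
      = (\<Sum>h\<in>fixer W. \<Sum>v\<in>UNIV. if h v = v then num_fixed_vectors h ^ j else 0)"
    by (simp add: num_fixed_vectors_def sum.If_cases)
  also have "\<dots> = (\<Sum>v\<in>UNIV. \<Sum>h\<in>fixer W. if h v = v then num_fixed_vectors h ^ j else 0)"
    by (rule sum.swap)
  also have "\<dots> = (\<Sum>v\<in>UNIV. \<Sum>h\<in>fixer (insert v W). num_fixed_vectors h ^ j)"
    by (simp add: fixer_insert sum.inter_filter)
  also have "\<dots> = (\<Sum>v\<in>W. \<Sum>h\<in>fixer (insert v W). num_fixed_vectors h ^ j)
      + (\<Sum>v\<in>- W. \<Sum>h\<in>fixer (insert v W). num_fixed_vectors h ^ j)"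
    by (rule sum.union_disjoint[of W "- W", simplified])
  also have "(\<Sum>v\<in>W. \<Sum>h\<in>fixer (insert v W). num_fixed_vectors h ^ j)
      = card (fixer W) * (card W ^ Suc j * ?P)"
    by (simp add: inside)
  also have "(\<Sum>v\<in>- W. \<Sum>h\<in>fixer (insert v W). num_fixed_vectors h ^ j)
      = (\<Sum>v\<in>- W. card (fixer (insert v W))) * ((?q * card W) ^ j * ?P)"
    by (simp add: outside sum_distrib_right)
  also have "\<dots> = card (fixer W) * (card W ^ Suc j * ?P * ?q ^ Suc j)"
    by (simp add: sum_card_fixer_insert[OF Suc.prems(1) le[of 2]] power_mult_distrib)
  \<comment> \<open>The vectors inside \<open>W\<close> contribute the 1 and those outside the
    \<open>?q ^ Suc j\<close> of the new factor.\<close>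
  also have "card (fixer W) * (card W ^ Suc j * ?P) + card (fixer W) * (card W ^ Suc j * ?P * ?q ^ Suc j)
      = card (fixer W) * (card W ^ Suc j * (\<Prod>i=1..Suc j. ?q ^ i + 1))"
    by (simp only: prod.nat_ivl_Suc' le_add2 add.commute[of 1] plus_1_eq_Suc)
       (simp add: algebra_simps)
  finally show ?case .
qed

end

theorem theorem4p6:
  fixes q n j :: nat
    and Q :: "'a::{field,finite} ^ 'm::finite \<Rightarrow> 'a"
  assumes "primepow q" and "odd q" and "CARD('a) = q"
    and "CARD('m) = 2 * n + 1"
    and "quadratic_form Q" and "nondegenerate Q"
    and "n \<ge> j"
  shows "measure_pmf.expectation (pmf_of_set (orthogonal_group Q))
           (\<lambda>g. real (num_fixed_vectors g) ^ j) = (\<Prod>i=1..j. (real q ^ i + 1))"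
proof -
  interpret odd_quadratic_space Q
    using assms by unfold_locales auto
  let ?O = "orthogonal_group Q"
  \<comment> \<open>The moment formula is applied to the zero subspace, which every isometry fixes
    and whose size 1 removes the power of \<open>card W\<close>.\<close>
  have fixer_0: "fixer {0} = ?O"
    using fixer_span[of "{}"] by (simp add: fixer_def)
  have "?O \<noteq> {}"
    using id_in_fixer[of "{0}"] fixer_0 by auto
  moreover have "1 < q"
    using assms(1) by (rule primepow_gt_Suc_0[unfolded One_nat_def[symmetric]])
  \<comment> \<open>This is the size bound for \<open>W = {0}\<close>; the odd dimension makes it
    strict even for \<open>j = n\<close>.\<close>
  then have "q ^ (2 * j) < q ^ (2 * n + 1)"
    using assms(7) by (intro power_strict_increasing) auto
  then have "(\<Sum>h\<in>?O. num_fixed_vectors h ^ j) = card ?O * (\<Prod>i=1..j. q ^ i + 1)"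
    using sum_fixed_vectors_power[of "{0}" j] assms(3,4) by (simp add: fixer_0)
  then have "(\<Sum>h\<in>?O. real (num_fixed_vectors h) ^ j) = real (card ?O) * (\<Prod>i=1..j. real q ^ i + 1)"
    by (metis (mono_tags, lifting) of_nat_1 of_nat_add of_nat_mult of_nat_power of_nat_prod of_nat_sum
        sum.cong prod.cong)
  ultimately show ?thesis
    by (simp add: integral_pmf_of_set card_eq_0_iff)
qed

end
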